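(* Let $q(x,y) = a x^2 + b x y + c y^2 + d x + e y + f \in \mathbb{Z}[x,y]$ with $\mathrm{Disc}(q) \neq 0$. Define $$\mathcal{A}(q) = \left\{ [x,y]_q = \begin{bmatrix} x-h_q & -c\,(y-k_q) \\ y-k_q & a\,(x-h_q) + b\,(y-k_q) \end{bmatrix} \;\middle|\; x,y \in \mathbb{Q} \right\},$$ $$\mathcal{R}(q) = \left\{ [u,v]_{q,0} = \begin{bmatrix} u & -c\,v \\ a\,v & u + b\,v \end{bmatrix} \;\middle|\; u,v \in \mathbb{Q} \right\}.$$ Then the following hold. (i) $\mathcal{A}(q)$ is a vector space over $\mathbb{Q}$ (under the usual matrix addition and scalar multiplication). (ii) $\mathcal{R}(q)$ is a commutative ring with identity (under the usual matrix operations). (iii) For all $A, B \in \mathcal{A}(q)$, the product $A \cdot B^*$ lies in $\mathcal{R}(q)$. (iv) $\mathcal{A}(q)$ is a left $\mathcal{R}(q)$-module (under matrix multiplication). (v) There exist $B_0, C_0 \in \mathcal{A}(q)$ such that $A \cdot B_0^* \cdot C_0 = A$ for all $A \in \mathcal{A}(q)$. Moreover, for all $\alpha \in \mathbb{Q}$ and $A,B,C,D,E \in \mathcal{A}(q)$: (1) (Multiplication) $A \cdot B^* \cdot C \in \mathcal{A}(q)$; (2) (Commutativity) $A \cdot B^* \cdot C = C \cdot B^* \cdot A$; (3) (Associativity) $(A \cdot B^* \cdot C) \cdot D^* \cdot E = A \cdot B^* \cdot (C \cdot D^* \cdot E)$; (4) (Distributivity) $(A + D) \cdot B^* \cdot C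 = A \cdot B^* \cdot C + D \cdot B^* \cdot C$; (5) (Linearity) $(\alpha A) \cdot B^* \cdot C = \alpha\,(A \cdot B^* \cdot C) = A \cdot B^* \cdot (\alpha C)$; (6) (Nondegeneracy) $A \cdot A^* \cdot A = 0$ if and only if $\det A = 0$.
   Context: For $q(x,y) = a x^2 + b x y + c y^2 + d x + e y + f \in \mathbb{Z}[x,y]$ define $$\mathrm{Det}(q) = \begin{vmatrix} a & b/2 & d/2 \\ b/2 & c & e/2 \\ d/2 & e/2 & f \end{vmatrix}, \qquad \mathrm{Disc}(q) = \begin{vmatrix} a & b/2 \\ b/2 & c \end{vmatrix} = ac - \frac{b^2}{4}.$$ When $\mathrm{Disc}(q) \neq 0$ define $$h_q = \frac{1}{\mathrm{Disc}(q)} \begin{vmatrix} b/2 & d/2 \\ c & e/2 \end{vmatrix}, \qquad k_q = -\frac{1}{\mathrm{Disc}(q)} \begin{vmatrix} a & d/2 \\ b/2 & e/2 \end{vmatrix}.$$ For a $2 \times 2$ matrix $B$, $B^*$ denotes the transpose of the cofactor matrix of $B$ (the adjugate), so $B^* \cdot B = (\det B) \cdot 1$. The dot denotes matrix multiplication. *)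

theory Defs
  imports "Jordan_Normal_Form.VS_Connect"
begin

(* The ring Z[x,y] is represented as Z[x][y]: the outer variable is y and the
   inner one is x, so "coeff (coeff q j) i" is the coefficient of x^i y^j. *)

definition quad_poly :: "int \<Rightarrow> int \<Rightarrow> int \<Rightarrow> int \<Rightarrow> int \<Rightarrow> int \<Rightarrow> int poly poly" where
  "quad_poly a b c d e f = [: [:f, d, a:], [:e, b:], [:c:] :]"

lemma poly_quad_poly:
  "poly (poly (quad_poly a b c d e f) [:y:]) x
    = a * x^2 + b * x * y + c * y^2 + d * x + e * y + f"
  by (simp add: quad_poly_def algebra_simps power2_eq_square)

definition coef_xy :: "int poly poly \<Rightarrow> nat \<Rightarrow> nat \<Rightarrow> rat" where
  "coef_xy q i j = of_int (coeff (coeff q j) i)"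

abbreviation (input) coef_a :: "int poly poly \<Rightarrow> rat" where "coef_a q \<equiv> coef_xy q 2 0"
abbreviation (input) coef_b :: "int poly poly \<Rightarrow> rat" where "coef_b q \<equiv> coef_xy q 1 1"
abbreviation (input) coef_c :: "int poly poly \<Rightarrow> rat" where "coef_c q \<equiv> coef_xy q 0 2"
abbreviation (input) coef_d :: "int poly poly \<Rightarrow> rat" where "coef_d q \<equiv> coef_xy q 1 0"
abbreviation (input) coef_e :: "int poly poly \<Rightarrow> rat" where "coef_e q \<equiv> coef_xy q 0 1"

lemma coef_quad_poly:
  "coef_xy (quad_poly a b c d e f) 2 0 = of_int a"
  "coef_xy (quad_poly a b c d e f) 1 1 = of_int b"
  "coef_xy (quad_poly a b c d e f) 0 2 = of_int c"
  "coef_xy (quad_poly a b c d e f) 1 0 = of_int d"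
  "coef_xy (quad_poly a b c d e f) 0 1 = of_int e"
  "coef_xy (quad_poly a b c d e f) 0 0 = of_int f"
  by (simp_all add: coef_xy_def quad_poly_def numeral_2_eq_2)

definition mat22 :: "rat \<Rightarrow> rat \<Rightarrow> rat \<Rightarrow> rat \<Rightarrow> rat mat" where
  "mat22 p q r s = mat_of_rows_list 2 [[p, q], [r, s]]"

definition Disc :: "int poly poly \<Rightarrow> rat" where
  "Disc q = det (mat22 (coef_a q) (coef_b q / 2)
                       (coef_b q / 2) (coef_c q))"

(* The center (h_q, k_q) is only meaningful when Disc q is nonzero. *)

definition h_center :: "int poly poly \<Rightarrow> rat" where
  "h_center q = 1 / Disc q * det (mat22 (coef_b q / 2) (coef_d q / 2)
                                        (coef_c q) (coef_e q / 2))"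

definition k_center :: "int poly poly \<Rightarrow> rat" where
  "k_center q = - (1 / Disc q) * det (mat22 (coef_a q) (coef_d q / 2)
                                            (coef_b q / 2) (coef_e q / 2))"

definition bracket :: "int poly poly \<Rightarrow> rat \<Rightarrow> rat \<Rightarrow> rat mat" where
  "bracket q x y =
    mat22 (x - h_center q) (- coef_c q * (y - k_center q))
          (y - k_center q) (coef_a q * (x - h_center q) + coef_b q * (y - k_center q))"

definition bracket0 :: "int poly poly \<Rightarrow> rat \<Rightarrow> rat \<Rightarrow> rat mat" where
  "bracket0 q u v =
    mat22 u (- coef_c q * v)
          (coef_a q * v) (u + coef_b q * v)"

definition calA :: "int poly poly \<Rightarrow> rat mat set" where
  "calA q = {bracket q x y | x y. True}"

definition calR :: "int poly poly \<Rightarrow> rat mat set" where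
  "calR q = {bracket0 q u v | u v. True}"

(* calA q with the Q-linear structure of the 2x2 matrices. *)
definition A_space :: "int poly poly \<Rightarrow> (rat, rat mat) module" where
  "A_space q = (module_mat TYPE(rat) 2 2)\<lparr>carrier := calA q\<rparr>"

(* calR q with the operations, zero and identity of the 2x2 matrix ring. *)
definition R_ring :: "int poly poly \<Rightarrow> rat mat ring" where
  "R_ring q = (ring_mat TYPE(rat) 2 ())\<lparr>carrier := calR q\<rparr>"

(* The scalars are now the matrices in calR q, acting by left multiplication.
   The fields mult and one are forced by the record type; the locale module
   makes no use of them. *)
definition A_module :: "int poly poly \<Rightarrow> (rat mat, rat mat) module" where
  "A_module q = \<lparr>carrier = calA q, mult = (*), one = 1\<^sub>m 2,
                 zero = 0\<^sub>m 2 2, add = (+), smult = (*)\<rparr>"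

end

(* Centering at (h_q, k_q) turns a bracket matrix into A = [[X, -c Y], [Y, a X + b Y]], whose
   determinant is the norm form a X^2 + b X Y + c Y^2.  A computation with entries gives
   calA * adj_mat calA \<subseteq> calR and calR * calA \<subseteq> calA, where calR is the commutative algebra over
   the rationals generated by [[0, -c], [a, b]]; the rest is matrix algebra with
   adj_mat B * B = det B * 1.  Since Disc q is nonzero, the norm form takes a nonzero value,
   which provides B0, with C0 = B0 / det B0. *)

theory Submission
  imports Defs
begin

section \<open>Entrywise calculus of 2 x 2 matrices\<close>

lemma mat22_carrier [simp]: "mat22 p q r s \<in> carrier_mat 2 2"
  by (simp add: mat22_def mat_of_rows_list_def numeral_2_eq_2)

lemma mat22_dim [simp]: "dim_row (mat22 p q r s) = 2" "dim_col (mat22 p q r s) = 2"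
  by (simp_all add: mat22_def mat_of_rows_list_def)

lemma mat22_index [simp]:
  "mat22 p q r s $$ (0, 0) = p" "mat22 p q r s $$ (0, Suc 0) = q"
  "mat22 p q r s $$ (Suc 0, 0) = r" "mat22 p q r s $$ (Suc 0, Suc 0) = s"
  by (simp_all add: mat22_def mat_of_rows_list_def)

lemma eq_mat22I:
  assumes "M \<in> carrier_mat 2 2" "M $$ (0, 0) = p" "M $$ (0, Suc 0) = q"
    "M $$ (Suc 0, 0) = r" "M $$ (Suc 0, Suc 0) = s"
  shows "M = mat22 p q r s"
  using assms by (intro eq_matI) (auto simp: less_2_cases_iff)

lemma mat22_add: "mat22 p q r s + mat22 p' q' r' s' = mat22 (p + p') (q + q') (r + r') (s + s')"
  by (rule eq_mat22I) simp_all

lemma mat22_smult: "k \<cdot>\<^sub>m mat22 p q r s = mat22 (k * p) (k * q) (k * r) (k * s)"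
  by (rule eq_mat22I) simp_all

lemma mat22_mult:
  "mat22 p q r s * mat22 p' q' r' s' =
    mat22 (p * p' + q * r') (p * q' + q * s') (r * p' + s * r') (r * q' + s * s')"
  by (rule eq_mat22I)
    (simp_all add: mult_carrier_mat[of _ 2 2] scalar_prod_def, simp_all add: numeral_2_eq_2)

lemma mat22_zero: "0\<^sub>m 2 2 = mat22 0 0 0 0"
  by (rule eq_mat22I) simp_all

lemma mat22_one: "1\<^sub>m 2 = mat22 1 0 0 1"
  by (rule eq_mat22I) simp_all

lemma mat22_det: "det (mat22 p q r s) = p * s - q * r"
  by (simp add: laplace_expansion_column[where n = 2 and j = 0] cofactor_def mat_delete_def
      det_single lessThan_nat_numeral)

lemma mat22_adj: "adj_mat (mat22 p q r s) = mat22 s (- q) (- r) p"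
  by (rule eq_mat22I)
    (simp_all add: adj_mat_def cofactor_def mat_delete_def det_single)

lemmas mat22_simps = mat22_add mat22_smult mat22_mult mat22_zero mat22_one mat22_adj

text \<open>Closure under scalar multiplication supplies negatives as
  \<open>(- 1) \<cdot>\<^sub>m A\<close>; the group laws are inherited from matrices. The record
  scheme is left open so that the ring and both module structures are covered at once.\<close>

lemma abelian_group_matI:
  fixes G :: "('a :: comm_ring_1 mat, 'b) ring_scheme"
  assumes G: "carrier G \<subseteq> carrier_mat nr nc" "add G = (+)" "zero G = 0\<^sub>m nr nc"
    and zero: "0\<^sub>m nr nc \<in> carrier G"
    and add: "\<And>A B. A \<in> carrier G \<Longrightarrow> B \<in> carrier G \<Longrightarrow> A + B \<in> carrier G"
    and smult: "\<And>k A. A \<in> carrier G \<Longrightarrow> k \<cdot>\<^sub>m A \<in> carrier G"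
  shows "abelian_group G"
proof (rule abelian_groupI, goal_cases)
  case (6 A)
  moreover from 6 have "(- 1) \<cdot>\<^sub>m A + A = 0\<^sub>m nr nc"
    using G(1) by (intro eq_matI) auto
  ultimately show ?case
    using G(2,3) smult by metis
next
  case (3 A B C)
  then show ?case
    using G by (auto intro!: assoc_add_mat[where nr = nr and nc = nc])
next
  case (4 A B)
  then show ?case
    using G by (auto intro!: comm_add_mat[where nr = nr and nc = nc])
next
  case (5 A)
  then show ?case
    using G by (auto intro!: left_add_zero_mat[where nr = nr and nc = nc])
qed (use G zero add in auto)

section \<open>The sets \<open>calA q\<close> and \<open>calR q\<close> in coordinates\<close>

definition centered :: "int poly poly \<Rightarrow> rat \<Rightarrow> rat \<Rightarrow> rat mat" where
  "centered q X Y = mat22 X (- coef_xy q 0 2 * Y) Y (coef_xy q 2 0 * X + coef_xy q 1 1 * Y)"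

text \<open>Translation by the center is a bijection of the rational plane, so
  \<open>h_center\<close> and \<open>k_center\<close> disappear from all later computations.\<close>

lemma calA_eq: "calA q = {centered q X Y | X Y. True}"
proof -
  have "bracket q x y = centered q (x - h_center q) (y - k_center q)" for x y
    by (simp add: bracket_def centered_def)
  moreover have "centered q X Y = bracket q (X + h_center q) (Y + k_center q)" for X Y
    by (simp add: bracket_def centered_def)
  ultimately show ?thesis
    unfolding calA_def by (metis (no_types))
qed

lemma centered_in_calA [simp]: "centered q X Y \<in> calA q"
  by (auto simp: calA_eq)

lemma calA_E:
  assumes "A \<in> calA q"
  obtains X Y where "A = centered q X Y"
  using assms by (auto simp: calA_eq)

lemma calR_E:
  assumes "R \<in> calR q"
  obtains u v where "R = bracket0 q u v"
  using assms by (auto simp: calR_def)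

lemma bracket0_in_calR [simp]: "bracket0 q u v \<in> calR q"
  by (auto simp: calR_def)

lemma calA_carrier: "calA q \<subseteq> carrier_mat 2 2"
  by (auto simp: centered_def elim!: calA_E)

lemma calR_carrier: "calR q \<subseteq> carrier_mat 2 2"
  by (auto simp: bracket0_def elim!: calR_E)

lemma centered_add: "centered q X Y + centered q X' Y' = centered q (X + X') (Y + Y')"
  by (simp add: centered_def mat22_simps algebra_simps)

lemma centered_smult: "k \<cdot>\<^sub>m centered q X Y = centered q (k * X) (k * Y)"
  by (simp add: centered_def mat22_simps algebra_simps)

lemma bracket0_add: "bracket0 q u v + bracket0 q u' v' = bracket0 q (u + u') (v + v')"
  by (simp add: bracket0_def mat22_simps algebra_simps)

lemma bracket0_smult: "k \<cdot>\<^sub>m bracket0 q u v = bracket0 q (k * u) (k * v)"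
  by (simp add: bracket0_def mat22_simps algebra_simps)

text \<open>With w = [[0, -c], [a, b]], the matrix \<open>bracket0 q u v\<close> is u + v w.
  Cayley-Hamilton gives w^2 = b w - a c, which reduces the product to this form.\<close>

lemma bracket0_mult:
  "bracket0 q u v * bracket0 q u' v' =
    bracket0 q (u * u' - coef_xy q 2 0 * coef_xy q 0 2 * v * v')
      (u * v' + v * u' + coef_xy q 1 1 * v * v')"
  by (simp add: bracket0_def mat22_simps algebra_simps)

text \<open>For w = [[0, -c], [a, b]] and the column z = (X, Y), \<open>centered q X Y\<close> has
  columns z and w z. Elements R of \<open>calR q\<close> commute with w, so the product has columns
  R z and w R z; the new coordinates are the entries of R z.\<close>

lemma bracket0_mult_centered:
  "bracket0 q u v * centered q X Y =
    centered q (u * X - coef_xy q 0 2 * v * Y)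
      (u * Y + v * (coef_xy q 2 0 * X + coef_xy q 1 1 * Y))"
  by (simp add: bracket0_def centered_def mat22_simps algebra_simps)

text \<open>For equal factors the second parameter vanishes and the first becomes the norm form, in
  accordance with \<open>A * adj_mat A\<close> being det A times the identity.\<close>

lemma centered_mult_adj:
  "centered q X Y * adj_mat (centered q X' Y') =
    bracket0 q (coef_xy q 2 0 * X * X' + coef_xy q 1 1 * X * Y' + coef_xy q 0 2 * Y * Y')
      (Y * X' - X * Y')"
  by (simp add: bracket0_def centered_def mat22_simps algebra_simps)

lemma det_centered:
  "det (centered q X Y) = coef_xy q 2 0 * X\<^sup>2 + coef_xy q 1 1 * X * Y + coef_xy q 0 2 * Y\<^sup>2"
  by (simp add: centered_def mat22_det algebra_simps power2_eq_square)

lemma calA_zero: "0\<^sub>m 2 2 \<in> calA q"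
  using centered_in_calA[of q 0 0] by (simp add: centered_def mat22_zero)

lemma calA_add: "A \<in> calA q \<Longrightarrow> B \<in> calA q \<Longrightarrow> A + B \<in> calA q"
  by (auto simp: centered_add elim!: calA_E)

lemma calA_smult: "A \<in> calA q \<Longrightarrow> k \<cdot>\<^sub>m A \<in> calA q"
  by (auto simp: centered_smult elim!: calA_E)

lemma calR_zero: "0\<^sub>m 2 2 \<in> calR q"
  using bracket0_in_calR[of q 0 0] by (simp add: bracket0_def mat22_zero)

lemma calR_one: "1\<^sub>m 2 \<in> calR q"
  using bracket0_in_calR[of q 1 0] by (simp add: bracket0_def mat22_one)

lemma calR_add: "R \<in> calR q \<Longrightarrow> S \<in> calR q \<Longrightarrow> R + S \<in> calR q"
  by (auto simp: bracket0_add elim!: calR_E)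

lemma calR_smult: "R \<in> calR q \<Longrightarrow> k \<cdot>\<^sub>m R \<in> calR q"
  by (auto simp: bracket0_smult elim!: calR_E)

lemma calR_mult: "R \<in> calR q \<Longrightarrow> S \<in> calR q \<Longrightarrow> R * S \<in> calR q"
  by (auto simp: bracket0_mult elim!: calR_E)

lemma calR_commute: "R \<in> calR q \<Longrightarrow> S \<in> calR q \<Longrightarrow> R * S = S * R"
  by (auto simp: bracket0_mult algebra_simps elim!: calR_E)

lemma calR_mult_calA: "R \<in> calR q \<Longrightarrow> A \<in> calA q \<Longrightarrow> R * A \<in> calA q"
  by (auto simp: bracket0_mult_centered elim!: calA_E calR_E)

lemma calA_mult_adj: "A \<in> calA q \<Longrightarrow> B \<in> calA q \<Longrightarrow> A * adj_mat B \<in> calR q"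
  by (auto simp: centered_mult_adj elim!: calA_E)

text \<open>For det B nonzero, the product is (1 / det B) times
  \<open>(A * adj_mat B) * (C * adj_mat B) * B\<close>, and the first two factors commute in
  \<open>calR q\<close>. The expansion in coordinates also covers singular B.\<close>

lemma calA_triple_commute:
  assumes "A \<in> calA q" "B \<in> calA q" "C \<in> calA q"
  shows "A * adj_mat B * C = C * adj_mat B * A"
  using assms
  by (auto simp: centered_mult_adj bracket0_mult_centered algebra_simps elim!: calA_E)

section \<open>Ring, vector space and module structures\<close>

lemma cring_R_ring: "cring (R_ring q)"
proof -
  have ab: "abelian_group (R_ring q)"
    by (rule abelian_group_matI[where nr = 2 and nc = 2])
      (use calR_carrier in \<open>auto simp: R_ring_def ring_mat_simps calR_zero calR_add calR_smult\<close>)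
  have car: "R \<in> carrier_mat 2 2" if "R \<in> calR q" for R
    using that calR_carrier by blast
  \<comment> \<open>Closure, the identity and commutativity are specific to \<open>calR q\<close>;
    associativity and the unit law come from matrices.\<close>
  have "comm_monoid (R_ring q)"
    by (rule comm_monoidI)
      (auto simp: R_ring_def ring_mat_simps calR_one calR_mult calR_commute
        dest!: car intro: assoc_mult_mat left_mult_one_mat)
  with ab show ?thesis
    by (rule cringI)
      (auto simp: R_ring_def ring_mat_simps dest!: car intro: add_mult_distrib_mat)
qed

lemma vectorspace_A_space: "vectorspace (class_ring :: rat ring) (A_space q)"
proof -
  have ab: "abelian_group (A_space q)"
    by (rule abelian_group_matI[where nr = 2 and nc = 2])
      (use calA_carrier in \<open>auto simp: A_space_def module_mat_simps calA_zero calA_add calA_smult\<close>)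
  have car: "A \<in> carrier_mat 2 2" if "A \<in> calA q" for A
    using that calA_carrier by blast
  have fld: "field (class_ring :: rat ring)"
    by (rule class_field)
  then have cr: "cring (class_ring :: rat ring)"
    by (simp add: field_def domain_def)
  have "Module.module (class_ring :: rat ring) (A_space q)"
    by (rule moduleI[OF cr ab])
      (auto simp: A_space_def module_mat_simps calA_smult dest!: car
        intro: add_smult_distrib_right_mat add_smult_distrib_left_mat)
  with fld show ?thesis
    by (simp add: vectorspace_def)
qed

text \<open>The scalars are themselves matrices, so beyond the closure \<open>calR_mult_calA\<close>
  the module axioms are the distributive, associative and unit laws of matrix
  multiplication.\<close>

lemma module_A_module: "Module.module (R_ring q) (A_module q)"
proof -
  have ab: "abelian_group (A_module q)"
    by (rule abelian_group_matI[where nr = 2 and nc = 2])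
      (use calA_carrier in \<open>auto simp: A_module_def calA_zero calA_add calA_smult\<close>)
  have carA: "A \<in> carrier_mat 2 2" if "A \<in> calA q" for A
    using that calA_carrier by blast
  have carR: "R \<in> carrier_mat 2 2" if "R \<in> calR q" for R
    using that calR_carrier by blast
  show ?thesis
    by (rule moduleI[OF cring_R_ring ab])
      (auto simp: A_module_def R_ring_def ring_mat_simps calR_mult_calA dest!: carA carR
        intro: add_mult_distrib_mat mult_add_distrib_mat assoc_mult_mat left_mult_one_mat)
qed

section \<open>The adjugate identity and nonsingular elements\<close>

lemma mult_adj_mult:
  assumes "A \<in> carrier_mat n n" "B \<in> carrier_mat n n"
  shows "A * adj_mat B * B = det B \<cdot>\<^sub>m A"
proof -
  \<comment> \<open>Regrouping brings \<open>adj_mat B * B\<close> together. Both the unit pair and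
    the nondegeneracy criterion rest on this identity.\<close>
  have "A * adj_mat B * B = A * (det B \<cdot>\<^sub>m 1\<^sub>m n)"
    using assms adj_mat[OF assms(2)] by simp
  also have "\<dots> = det B \<cdot>\<^sub>m A"
    using assms(1) by (simp add: mult_smult_distrib[where nr = n and n = n and nc = n])
  finally show ?thesis .
qed

text \<open>The norm form takes the values a, c and a + b + c at (1,0), (0,1) and (1,1). If all
  three vanished, then a = b = c = 0 and the discriminant would be zero.\<close>

lemma exists_det_nonzero:
  assumes "Disc q \<noteq> 0"
  obtains B where "B \<in> calA q" "det B \<noteq> 0"
proof -
  have "\<exists>B \<in> {centered q 1 0, centered q 0 1, centered q 1 1}. det B \<noteq> 0"
    using assms by (auto simp: det_centered Disc_def mat22_det)
  then show ?thesis
    using that centered_in_calA by blast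
qed

theorem theorem2p1:
  fixes a b c d e f :: int and q :: "int poly poly"
  assumes q: "q = quad_poly a b c d e f"
    and nondegenerate: "Disc q \<noteq> 0"
  shows
    "vectorspace (class_ring :: rat ring) (A_space q) \<and>
     cring (R_ring q) \<and>
     (\<forall>A\<in>calA q. \<forall>B\<in>calA q. A * adj_mat B \<in> calR q) \<and>
     Module.module (R_ring q) (A_module q) \<and>
     (\<exists>B\<^sub>0\<in>calA q. \<exists>C\<^sub>0\<in>calA q. \<forall>A\<in>calA q. A * adj_mat B\<^sub>0 * C\<^sub>0 = A) \<and>
     (\<forall>\<alpha>::rat. \<forall>A\<in>calA q. \<forall>B\<in>calA q. \<forall>C\<in>calA q. \<forall>D\<in>calA q. \<forall>E\<in>calA q.
        A * adj_mat B * C \<in> calA q \<and>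
        A * adj_mat B * C = C * adj_mat B * A \<and>
        (A * adj_mat B * C) * adj_mat D * E = A * adj_mat B * (C * adj_mat D * E) \<and>
        (A + D) * adj_mat B * C = A * adj_mat B * C + D * adj_mat B * C \<and>
        (\<alpha> \<cdot>\<^sub>m A) * adj_mat B * C = \<alpha> \<cdot>\<^sub>m (A * adj_mat B * C) \<and>
        \<alpha> \<cdot>\<^sub>m (A * adj_mat B * C) = A * adj_mat B * (\<alpha> \<cdot>\<^sub>m C) \<and>
        (A * adj_mat A * A = 0\<^sub>m 2 2 \<longleftrightarrow> det A = 0))"
proof -
  have A_car [simp]: "A \<in> carrier_mat 2 2" and adj_car [simp]: "adj_mat A \<in> carrier_mat 2 2"
    if "A \<in> calA q" for A
    using that calA_carrier adj_mat(1) by blast+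
  have mult_car [simp]: "A * adj_mat B \<in> carrier_mat 2 2" if "A \<in> calA q" "B \<in> calA q" for A B
    using that by (intro mult_carrier_mat[where n = 2]) auto
  note assoc_mult_mat_2 =
    assoc_mult_mat[where ?n\<^sub>1.0 = 2 and ?n\<^sub>2.0 = 2 and ?n\<^sub>3.0 = 2 and ?n\<^sub>4.0 = 2]
  have unit: "\<exists>B\<^sub>0\<in>calA q. \<exists>C\<^sub>0\<in>calA q. \<forall>A\<in>calA q. A * adj_mat B\<^sub>0 * C\<^sub>0 = A"
  proof -
    obtain B where B: "B \<in> calA q" "det B \<noteq> 0"
      using exists_det_nonzero[OF nondegenerate] .
    have "A * adj_mat B * ((1 / det B) \<cdot>\<^sub>m B) = A" if A: "A \<in> calA q" for A
    proof -
      have "A * adj_mat B * ((1 / det B) \<cdot>\<^sub>m B) = (1 / det B) \<cdot>\<^sub>m (A * adj_mat B * B)"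
        using A B by (intro mult_smult_distrib[where nr = 2 and n = 2 and nc = 2]) auto
      also have "\<dots> = (1 / det B) \<cdot>\<^sub>m (det B \<cdot>\<^sub>m A)"
        using A B by (simp add: mult_adj_mult[where n = 2])
      also have "\<dots> = A"
        using B by (intro eq_matI) auto
      finally show ?thesis .
    qed
    with B show ?thesis
      using calA_smult by blast
  qed
  have closed: "A * adj_mat B * C \<in> calA q"
    if "A \<in> calA q" "B \<in> calA q" "C \<in> calA q" for A B C
    \<comment> \<open>The product \<open>A * adj_mat B\<close> is a scalar in \<open>calR q\<close>
      acting on C.\<close>
    using that by (intro calR_mult_calA calA_mult_adj)
  have assoc: "(A * adj_mat B * C) * adj_mat D * E = A * adj_mat B * (C * adj_mat D * E)"
    if "A \<in> calA q" "B \<in> calA q" "C \<in> calA q" "D \<in> calA q" "E \<in> calA q" for A B C D E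
  proof -
    \<comment> \<open>Keeping \<open>A * adj_mat B\<close> as one factor, two uses of matrix
      associativity suffice.\<close>
    have "A * adj_mat B * C * adj_mat D = A * adj_mat B * (C * adj_mat D)"
      using that by (intro assoc_mult_mat_2) auto
    also have "\<dots> * E = A * adj_mat B * (C * adj_mat D * E)"
      using that by (intro assoc_mult_mat_2) auto
    finally show ?thesis .
  qed
  have distrib: "(A + D) * adj_mat B * C = A * adj_mat B * C + D * adj_mat B * C"
    if "A \<in> calA q" "B \<in> calA q" "C \<in> calA q" "D \<in> calA q" for A B C D
    using that by (simp add: add_mult_distrib_mat[where nr = 2 and n = 2 and nc = 2])
  have linear: "(\<alpha> \<cdot>\<^sub>m A) * adj_mat B * C = \<alpha> \<cdot>\<^sub>m (A * adj_mat B * C)"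
    "\<alpha> \<cdot>\<^sub>m (A * adj_mat B * C) = A * adj_mat B * (\<alpha> \<cdot>\<^sub>m C)"
    if "A \<in> calA q" "B \<in> calA q" "C \<in> calA q" for \<alpha> A B C
    using that
    by (simp_all add: mult_smult_assoc_mat[where nr = 2 and n = 2 and nc = 2]
        mult_smult_distrib[where nr = 2 and n = 2 and nc = 2])
  have zero_iff: "A * adj_mat A * A = 0\<^sub>m 2 2 \<longleftrightarrow> det A = 0" if A: "A \<in> calA q" for A
  proof -
    obtain X Y where [simp]: "A = centered q X Y"
      using A by (rule calA_E)
    have "A * adj_mat A * A = centered q (det A * X) (det A * Y)"
      using A by (simp add: mult_adj_mult[where n = 2] centered_smult)
    \<comment> \<open>The first column of a centered matrix consists of its coordinates.\<close>
    moreover have "centered q X' Y' = 0\<^sub>m 2 2 \<longleftrightarrow> X' = 0 \<and> Y' = 0" for X' Y'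
      by (metis centered_def mat22_zero mat22_index(1,3) mult_zero_right add_0)
    \<comment> \<open>A nonzero determinant would force X = Y = 0, where the norm form
      vanishes.\<close>
    ultimately show ?thesis
      by (auto simp: det_centered)
  qed
  show ?thesis
    using vectorspace_A_space cring_R_ring calA_mult_adj module_A_module unit
      closed calA_triple_commute assoc distrib linear zero_iff
    by (intro conjI ballI allI) auto
qed

end
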